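(* Let $X$ be a monotone determined space. If $X$ is Lawson compact, then $X$ is a dcpo endowed with the Scott topology; that is, $X$ is a dcpo with respect to its specialization order, and the topology of $X$ is the Scott topology of this order.
   Context: For a $T_0$ space $X$ with topology $\mathcal{O}(X)$, the specialization order is $x\le y$ iff $x\in\overline{\{y\}}$. Directed sets are nonempty. A directed subset $D\subseteq X$ converges to $x$, $D\to x$, iff $D\cap U\neq\emptyset$ for every open $U\ni x$. $X$ is a monotone determined space if it is $T_0$ and every $U\subseteq X$ with the property "for all directed $D\subseteq X$ and all $x\in U$ with $D\to x$, $D\cap U\neq\emptyset$" is open. The Lawson topology $\lambda(X)$ on a monotone determined space $X$ is the topology generated by $\mathcal{O}(X)\cup\omega(X)$, where $\omega(X)$ is the lower topology for the specialization order (generated by the sets $X\setminus\{x: y\le x\}$, $y\in X$). $X$ is Lawson compact if $(X,\lambda(X))$ is compact (no separation axiom assumed). A dcpo is a poset in which every directed subset has a supremum. *)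

theory Defs
  imports "HOL-Analysis.Abstract_Topological_Spaces"
begin

text \<open>
  Posets are given, as in \<^theory>\<open>HOL.Order_Relation\<close>, by a carrier \<open>A\<close> and a relation \<open>r\<close> with
  \<open>partial_order_on A r\<close>, where \<open>(x, y) \<in> r\<close> means \<open>x \<le> y\<close>.
\<close>

definition directed_on :: "'a set \<Rightarrow> 'a rel \<Rightarrow> 'a set \<Rightarrow> bool" where
  "directed_on A r D \<longleftrightarrow>
     D \<subseteq> A \<and> D \<noteq> {} \<and> (\<forall>x\<in>D. \<forall>y\<in>D. \<exists>z\<in>D. (x, z) \<in> r \<and> (y, z) \<in> r)"

definition is_sup_on :: "'a set \<Rightarrow> 'a rel \<Rightarrow> 'a set \<Rightarrow> 'a \<Rightarrow> bool" where
  "is_sup_on A r D s \<longleftrightarrow>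
     s \<in> A \<and> (\<forall>d\<in>D. (d, s) \<in> r) \<and> (\<forall>u\<in>A. (\<forall>d\<in>D. (d, u) \<in> r) \<longrightarrow> (s, u) \<in> r)"

definition dcpo_on :: "'a set \<Rightarrow> 'a rel \<Rightarrow> bool" where
  "dcpo_on A r \<longleftrightarrow>
     partial_order_on A r \<and> (\<forall>D. directed_on A r D \<longrightarrow> (\<exists>s. is_sup_on A r D s))"

definition scott_open :: "'a set \<Rightarrow> 'a rel \<Rightarrow> 'a set \<Rightarrow> bool" where
  "scott_open A r U \<longleftrightarrow>
     U \<subseteq> A \<and>
     (\<forall>x\<in>U. \<forall>y\<in>A. (x, y) \<in> r \<longrightarrow> y \<in> U) \<and>
     (\<forall>D s. directed_on A r D \<and> is_sup_on A r D s \<and> s \<in> U \<longrightarrow> D \<inter> U \<noteq> {})"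

definition scott_topology :: "'a set \<Rightarrow> 'a rel \<Rightarrow> 'a topology" where
  "scott_topology A r = topology (scott_open A r)"

lemma scott_openD:
  assumes "scott_open A r U"
  shows "U \<subseteq> A"
    and "\<And>x y. x \<in> U \<Longrightarrow> y \<in> A \<Longrightarrow> (x, y) \<in> r \<Longrightarrow> y \<in> U"
    and "\<And>D s. directed_on A r D \<Longrightarrow> is_sup_on A r D s \<Longrightarrow> s \<in> U \<Longrightarrow> \<exists>d. d \<in> D \<and> d \<in> U"
proof -
  note * = assms [unfolded scott_open_def disjoint_iff]
  show "U \<subseteq> A"
    using * by (elim conjE)
  show "y \<in> U" if "x \<in> U" "y \<in> A" "(x, y) \<in> r" for x y
    using conjunct1 [OF conjunct2 [OF *]] that by simp
  show "\<exists>d. d \<in> D \<and> d \<in> U"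
    if "directed_on A r D" "is_sup_on A r D s" "s \<in> U" for D s
    using conjunct2 [OF conjunct2 [OF *], rule_format, of D s] that by simp
qed

lemma scott_openI:
  assumes "U \<subseteq> A"
    and "\<And>x y. x \<in> U \<Longrightarrow> y \<in> A \<Longrightarrow> (x, y) \<in> r \<Longrightarrow> y \<in> U"
    and "\<And>D s. directed_on A r D \<Longrightarrow> is_sup_on A r D s \<Longrightarrow> s \<in> U \<Longrightarrow> \<exists>d. d \<in> D \<and> d \<in> U"
  shows "scott_open A r U"
  unfolding scott_open_def
proof (intro conjI ballI allI impI)
  fix D s assume "directed_on A r D \<and> is_sup_on A r D s \<and> s \<in> U"
  then have "\<exists>d. d \<in> D \<and> d \<in> U"
    using assms(3) [of D s] by simp
  then show "D \<inter> U \<noteq> {}" by auto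
qed (use assms(1,2) in simp_all)

lemma istopology_scott_open: "istopology (scott_open A r)"
  unfolding istopology_def
proof (intro conjI allI impI)
  fix U V assume U: "scott_open A r U" and V: "scott_open A r V"
  show "scott_open A r (U \<inter> V)"
  proof (rule scott_openI)
    show "U \<inter> V \<subseteq> A"
      using scott_openD(1) [OF U] by (rule le_infI1)
    show "y \<in> U \<inter> V" if "x \<in> U \<inter> V" "y \<in> A" "(x, y) \<in> r" for x y
      using that scott_openD(2) [OF U, of x y] scott_openD(2) [OF V, of x y] by simp
    show "\<exists>d. d \<in> D \<and> d \<in> U \<inter> V"
      if D: "directed_on A r D" and s: "is_sup_on A r D s" "s \<in> U \<inter> V" for D s
    proof -
      from s(2) have "s \<in> U" "s \<in> V" by simp_all
      obtain d where d: "d \<in> D" "d \<in> U"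
        using scott_openD(3) [OF U D s(1) \<open>s \<in> U\<close>] by (elim exE conjE)
      obtain e where e: "e \<in> D" "e \<in> V"
        using scott_openD(3) [OF V D s(1) \<open>s \<in> V\<close>] by (elim exE conjE)
      have "D \<subseteq> A" "\<exists>f\<in>D. (d, f) \<in> r \<and> (e, f) \<in> r"
        using D d(1) e(1) unfolding directed_on_def by simp_all
      then obtain f where f: "f \<in> D" "f \<in> A" "(d, f) \<in> r" "(e, f) \<in> r"
        by auto
      then show ?thesis
        using scott_openD(2) [OF U d(2)] scott_openD(2) [OF V e(2)] by auto
    qed
  qed
next
  fix \<U> assume *: "\<forall>U\<in>\<U>. scott_open A r U"
  show "scott_open A r (\<Union>\<U>)"
  proof (rule scott_openI)
    show "\<Union>\<U> \<subseteq> A"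
    proof (rule Union_least)
      show "U \<subseteq> A" if "U \<in> \<U>" for U
        using * that scott_openD(1) [of A r U] by simp
    qed
    show "y \<in> \<Union>\<U>" if xy: "x \<in> \<Union>\<U>" "y \<in> A" "(x, y) \<in> r" for x y
    proof -
      from xy(1) obtain U where U: "U \<in> \<U>" "x \<in> U" by auto
      then have "scott_open A r U" using * by simp
      from scott_openD(2) [OF this U(2) xy(2,3)] U(1) show ?thesis by auto
    qed
    show "\<exists>d. d \<in> D \<and> d \<in> \<Union>\<U>"
      if D: "directed_on A r D" "is_sup_on A r D s" and s: "s \<in> \<Union>\<U>" for D s
    proof -
      from s obtain U where U: "U \<in> \<U>" "s \<in> U" by auto
      then have "scott_open A r U" using * by simp
      from scott_openD(3) [OF this D U(2)] U(1) show ?thesis by auto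
    qed
  qed
qed

lemma openin_scott_topology: "openin (scott_topology A r) U \<longleftrightarrow> scott_open A r U"
  by (simp add: scott_topology_def istopology_scott_open)

text \<open>
  The carrier is added to the subbasis because \<open>topology_generated_by\<close> closes under binary
  intersections only; without it a greatest element would be missing from the underlying set.
\<close>

definition lower_topology :: "'a set \<Rightarrow> 'a rel \<Rightarrow> 'a topology" where
  "lower_topology A r =
     topology_generated_by (insert A {A - {x \<in> A. (y, x) \<in> r} | y. y \<in> A})"

definition specialization_order :: "'a topology \<Rightarrow> 'a rel" where
  "specialization_order X =
     {(x, y). x \<in> topspace X \<and> y \<in> topspace X \<and> x \<in> X closure_of {y}}"

definition directed_in :: "'a topology \<Rightarrow> 'a set \<Rightarrow> bool" where
  "directed_in X D \<longleftrightarrow> directed_on (topspace X) (specialization_order X) D"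

definition directed_converges :: "'a topology \<Rightarrow> 'a set \<Rightarrow> 'a \<Rightarrow> bool" where
  "directed_converges X D x \<longleftrightarrow> (\<forall>U. openin X U \<and> x \<in> U \<longrightarrow> D \<inter> U \<noteq> {})"

definition monotone_determined_space :: "'a topology \<Rightarrow> bool" where
  "monotone_determined_space X \<longleftrightarrow>
     t0_space X \<and>
     (\<forall>U. U \<subseteq> topspace X \<and>
          (\<forall>D x. directed_in X D \<and> x \<in> U \<and> directed_converges X D x \<longrightarrow> D \<inter> U \<noteq> {})
        \<longrightarrow> openin X U)"

definition lawson_topology :: "'a topology \<Rightarrow> 'a topology" where
  "lawson_topology X =
     topology_generated_by
       ({U. openin X U} \<union>
        {U. openin (lower_topology (topspace X) (specialization_order X)) U})"

lemma topspace_lower_topology [simp]: "topspace (lower_topology A r) = A"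
  unfolding lower_topology_def topology_generated_by_topspace by auto

lemma topspace_lawson_topology [simp]: "topspace (lawson_topology X) = topspace X"
proof -
  let ?L = "lower_topology (topspace X) (specialization_order X)"
  have "topspace (lawson_topology X) = \<Union>{U. openin X U} \<union> \<Union>{U. openin ?L U}"
    unfolding lawson_topology_def topology_generated_by_topspace by (rule Union_Un_distrib)
  also have "\<dots> = topspace X \<union> topspace ?L"
    by (simp only: topspace_def [symmetric])
  finally show ?thesis
    by simp
qed

definition lawson_compact :: "'a topology \<Rightarrow> bool" where
  "lawson_compact X \<longleftrightarrow> compact_space (lawson_topology X)"

end

theory Submission
  imports Defs
begin

text \<open>
  For directed \<open>D\<close>, every principal filter of an element of \<open>D\<close> and every closed set of \<open>X\<close> that
  contains \<open>D\<close> is Lawson closed and contains a tail of \<open>D\<close>.  These sets therefore have the finite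
  intersection property, and by Lawson compactness they have a common point \<open>s\<close>: an upper bound
  of \<open>D\<close> in the closure of \<open>D\<close>.  Since principal ideals are closed, \<open>s\<close> is the supremum of \<open>D\<close>, and
  \<open>D\<close> converges to \<open>s\<close>, so that open sets are Scott open.  Conversely, limits of \<open>D\<close>
  lie below \<open>s\<close>, so in a monotone determined space Scott open sets are open.
\<close>

text \<open>Rephrasing the closure condition by open neighbourhoods makes open sets visibly upper
  sets, the form in which the order is used from here on.\<close>

lemma specialization_order_iff:
  "(x, y) \<in> specialization_order X \<longleftrightarrow>
     x \<in> topspace X \<and> y \<in> topspace X \<and> (\<forall>U. openin X U \<and> x \<in> U \<longrightarrow> y \<in> U)"
  unfolding specialization_order_def in_closure_of by auto

lemma partial_order_specialization_order:
  assumes "t0_space X"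
  shows "partial_order_on (topspace X) (specialization_order X)"
proof -
  have "antisym (specialization_order X)"
    \<comment> \<open>An open set separating two distinct points refutes one of the two inequalities
      between them.\<close>
    using assms unfolding t0_space_def by (intro antisymI) (metis specialization_order_iff)
  moreover have "trans (specialization_order X)"
    by (intro transI) (simp add: specialization_order_iff)
  moreover have "refl_on (topspace X) (specialization_order X)"
    by (simp add: refl_on_def specialization_order_iff)
  moreover have "specialization_order X \<subseteq> topspace X \<times> topspace X"
    by (auto simp: specialization_order_iff)
  ultimately show ?thesis
    unfolding partial_order_on_def preorder_on_def by blast
qed

lemma closedin_lawson_topology:
  assumes "closedin X C"
  shows "closedin (lawson_topology X) C"
proof -
  have "openin (lawson_topology X) (topspace X - C)"
    unfolding lawson_topology_def using assms by (intro topology_generated_by_Basis) blast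
  then show ?thesis
    using closedin_subset [OF assms] unfolding closedin_def by simp
qed

lemma closedin_lawson_topology_principal_filter:
  assumes "y \<in> topspace X"
  shows "closedin (lawson_topology X) {x \<in> topspace X. (y, x) \<in> specialization_order X}"
proof -
  have "openin (lower_topology (topspace X) (specialization_order X))
          (topspace X - {x \<in> topspace X. (y, x) \<in> specialization_order X})"
    unfolding lower_topology_def using assms by (intro topology_generated_by_Basis) blast
  then have "openin (lawson_topology X)
          (topspace X - {x \<in> topspace X. (y, x) \<in> specialization_order X})"
    unfolding lawson_topology_def by (intro topology_generated_by_Basis) blast
  then show ?thesis
    unfolding closedin_def by auto
qed

text \<open>By transitivity, the tail above a common upper bound of two thresholds lies in both
  tails, so induction on \<open>\<F>\<close> applies. The empty family needs \<open>D\<close> to be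
  nonempty.\<close>

lemma directed_on_finite_tail:
  assumes D: "directed_on A r D" and "trans r" and "finite \<F>"
    and "\<And>C. C \<in> \<F> \<Longrightarrow> \<exists>d\<in>D. \<forall>e\<in>D. (d, e) \<in> r \<longrightarrow> e \<in> C"
  shows "\<exists>d\<in>D. \<forall>e\<in>D. (d, e) \<in> r \<longrightarrow> e \<in> \<Inter>\<F>"
  using assms(3,4)
proof (induction \<F>)
  case empty
  then show ?case
    using D unfolding directed_on_def by auto
next
  case (insert C \<F>)
  obtain d where d: "d \<in> D" "\<forall>e\<in>D. (d, e) \<in> r \<longrightarrow> e \<in> \<Inter>\<F>"
    using insert by auto
  obtain d' where d': "d' \<in> D" "\<forall>e\<in>D. (d', e) \<in> r \<longrightarrow> e \<in> C"
    using insert.prems by blast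
  obtain f where "f \<in> D" "(d, f) \<in> r" "(d', f) \<in> r"
    using D d(1) d'(1) unfolding directed_on_def by blast
  then show ?case
    using d(2) d'(2) \<open>trans r\<close> by (intro bexI [of _ f]) (auto dest: transD)
qed

lemma lawson_compact_directed_upper_bound:
  assumes "lawson_compact X" and D: "directed_in X D"
  obtains s where "s \<in> topspace X" "\<And>d. d \<in> D \<Longrightarrow> (d, s) \<in> specialization_order X"
    "s \<in> X closure_of D"
proof -
  let ?r = "specialization_order X"
  define up where "up d = {x \<in> topspace X. (d, x) \<in> ?r}" for d
  define \<C> where "\<C> = insert (X closure_of D) (up ` D)"
  have dir: "directed_on (topspace X) ?r D"
    using D unfolding directed_in_def .
  then have D_sub: "D \<subseteq> topspace X" and "D \<noteq> {}"
    unfolding directed_on_def by auto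
  have trans: "trans ?r"
    by (intro transI) (simp add: specialization_order_iff)
  have closed: "closedin (lawson_topology X) C" if "C \<in> \<C>" for C
    using that unfolding \<C>_def
  proof (elim insertE imageE)
    show "closedin (lawson_topology X) C" if "C = X closure_of D"
      unfolding that by (rule closedin_lawson_topology [OF closedin_closure_of])
    show "closedin (lawson_topology X) C" if "C = up d" "d \<in> D" for d
      unfolding that(1) up_def
      by (rule closedin_lawson_topology_principal_filter) (use D_sub that(2) in blast)
  qed
  have tail: "\<exists>d\<in>D. \<forall>e\<in>D. (d, e) \<in> ?r \<longrightarrow> e \<in> C" if "C \<in> \<C>" for C
    using that unfolding \<C>_def
  proof (elim insertE imageE)
    show "\<exists>d\<in>D. \<forall>e\<in>D. (d, e) \<in> ?r \<longrightarrow> e \<in> C" if "C = X closure_of D"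
      using \<open>D \<noteq> {}\<close> closure_of_subset [OF D_sub] that by auto
    show "\<exists>d\<in>D. \<forall>e\<in>D. (d, e) \<in> ?r \<longrightarrow> e \<in> C" if "C = up d" "d \<in> D" for d
      using D_sub that by (auto simp: up_def)
  qed
  have "\<Inter>\<F> \<noteq> {}" if fin: "finite \<F>" and sub: "\<F> \<subseteq> \<C>" for \<F>
  proof -
    obtain d where "d \<in> D" "\<forall>e\<in>D. (d, e) \<in> ?r \<longrightarrow> e \<in> \<Inter>\<F>"
      using directed_on_finite_tail [OF dir trans fin tail] sub by blast
    \<comment> \<open>Reflexivity puts \<open>d\<close> into its own tail, so \<open>d\<close>
      itself witnesses that the intersection is nonempty.\<close>
    moreover from \<open>d \<in> D\<close> have "(d, d) \<in> ?r"
      using D_sub by (auto simp: specialization_order_iff)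
    ultimately show ?thesis
      by blast
  qed
  with assms(1) closed have "\<Inter>\<C> \<noteq> {}"
    unfolding lawson_compact_def compact_space_fip by simp
  then obtain s where "s \<in> \<Inter>\<C>"
    by blast
  then have "s \<in> X closure_of D" "\<forall>d\<in>D. s \<in> up d"
    unfolding \<C>_def by auto
  then show thesis
    using that [of s] in_closure_of [of s X D] by (simp add: up_def)
qed

text \<open>Any open neighbourhood of \<open>s\<close> meets \<open>D\<close>, hence contains every
  upper bound \<open>u\<close> of \<open>D\<close>; this says that \<open>s\<close> lies below
  \<open>u\<close>.\<close>

lemma is_sup_on_specialization_orderI:
  assumes "s \<in> topspace X" "\<And>d. d \<in> D \<Longrightarrow> (d, s) \<in> specialization_order X"
    and "s \<in> X closure_of D"
  shows "is_sup_on (topspace X) (specialization_order X) D s"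
  using assms unfolding is_sup_on_def specialization_order_iff in_closure_of by blast

text \<open>An open neighbourhood of \<open>x\<close> contains some \<open>d\<close> in
  \<open>D\<close>, and with it \<open>s\<close>, because open sets are upper sets.\<close>

lemma directed_converges_le_upper_bound:
  assumes "directed_converges X D x" "x \<in> topspace X" "s \<in> topspace X"
    and "\<And>d. d \<in> D \<Longrightarrow> (d, s) \<in> specialization_order X"
  shows "(x, s) \<in> specialization_order X"
  using assms unfolding directed_converges_def specialization_order_iff by blast

theorem proposition4p8:
  fixes X :: "'a topology"
  assumes "monotone_determined_space X"
    and "lawson_compact X"
  shows "dcpo_on (topspace X) (specialization_order X) \<and>
         X = scott_topology (topspace X) (specialization_order X)"
proof -
  let ?A = "topspace X" and ?r = "specialization_order X"
  have po: "partial_order_on ?A ?r"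
    using assms(1) partial_order_specialization_order
    unfolding monotone_determined_space_def by blast
  have sup: "\<exists>s. is_sup_on ?A ?r D s \<and> s \<in> X closure_of D" if D: "directed_on ?A ?r D" for D
  proof -
    from D have "directed_in X D"
      unfolding directed_in_def .
    from lawson_compact_directed_upper_bound [OF assms(2) this] show ?thesis
      using is_sup_on_specialization_orderI by metis
  qed
  have scott: "scott_open ?A ?r U" if U: "openin X U" for U
  proof (rule scott_openI)
    show "U \<subseteq> ?A"
      using U by (rule openin_subset)
    show "y \<in> U" if "x \<in> U" "(x, y) \<in> ?r" for x y
      using that U unfolding specialization_order_iff by blast
    show "\<exists>d. d \<in> D \<and> d \<in> U"
      if D: "directed_on ?A ?r D" and s: "is_sup_on ?A ?r D s" "s \<in> U" for D s
    proof -
      \<comment> \<open>The given supremum \<open>s\<close> is not yet known to be in the closure of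
        \<open>D\<close>. The argument passes to \<open>t\<close>, which is in the closure and
        belongs to \<open>U\<close> since \<open>s\<close> lies below it.\<close>
      obtain t where t: "is_sup_on ?A ?r D t" "t \<in> X closure_of D"
        using sup [OF D] by blast
      have "(s, t) \<in> ?r"
        using s(1) t(1) unfolding is_sup_on_def by blast
      then have "t \<in> U"
        using s(2) U unfolding specialization_order_iff by blast
      then show ?thesis
        using t(2) U unfolding in_closure_of by blast
    qed
  qed
  have "openin X U" if U: "scott_open ?A ?r U" for U
  proof -
    \<comment> \<open>This is the openness test of a monotone determined space. The limit
      \<open>x\<close> need not be the supremum of \<open>D\<close>, but it lies below it, so the
      upper set \<open>U\<close> contains the supremum and Scott openness applies there.\<close>
    have "D \<inter> U \<noteq> {}" if D: "directed_in X D" and x: "x \<in> U" "directed_converges X D x" for D x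
    proof -
      have dir: "directed_on ?A ?r D"
        using D unfolding directed_in_def .
      then obtain s where s: "is_sup_on ?A ?r D s"
        using sup by blast
      have "x \<in> ?A"
        using scott_openD(1) [OF U] x(1) by blast
      then have "(x, s) \<in> ?r"
        using directed_converges_le_upper_bound [OF x(2)] s unfolding is_sup_on_def by blast
      then have "s \<in> U"
        using scott_openD(2) [OF U x(1)] unfolding specialization_order_iff by blast
      then show ?thesis
        using scott_openD(3) [OF U dir s] by blast
    qed
    then show ?thesis
      using assms(1) scott_openD(1) [OF U] unfolding monotone_determined_space_def by blast
  qed
  with scott have "X = scott_topology ?A ?r"
    unfolding topology_eq openin_scott_topology by blast
  then show ?thesis
    using po sup unfolding dcpo_on_def by blast
qed

end
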